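(* Let $X,Y$ be two compact topological spaces endowed with two continuous functions $\vec\varphi:X\to\mathbb{R}^n$, $\vec\psi:Y\to\mathbb{R}^n$. Let $k\in\mathbb{Z}$, let homology coefficients be taken in an Abelian group $G$, and let $(\vec u,\vec v),(\vec u',\vec v')\in\Delta^+$. If no surjective homomorphism exists from a subgroup of $H_k^{(X,\vec\varphi)}(\vec u,\vec v)$ onto $H_k^{(Y,\vec\psi)}(\vec u',\vec v')$, then $$\delta\left((X,\vec\varphi),(Y,\vec\psi)\right)\ge\min_{1\le i\le n}\min\{u_i-u'_i,\ v'_i-v_i\}.$$
   Context: For $\vec u,\vec v\in\mathbb{R}^n$ write $\vec u\preceq\vec v$ (resp. $\vec u\prec\vec v$) if $u_i\le v_i$ (resp. $u_i<v_i$) for all $i$. Let $\Delta^+=\{(\vec u,\vec v)\in\mathbb{R}^n\times\mathbb{R}^n:\vec u\prec\vec v\}$. For a function $\vec\varphi:X\to\mathbb{R}^n$ put $X\langle\vec\varphi\preceq\vec u\rangle=\{x\in X:\varphi_i(x)\le u_i,\ i=1,\dots,n\}$. $\mathbb{R}^n$ carries the max-norm $\|\vec u\|_\infty=\max_i|u_i|$, and for $X$ compact and $\vec\varphi$ continuous, $\|\vec\varphi\|_\infty=\max_{x\in X}\|\vec\varphi(x)\|_\infty$. Persistent homology group: $H_k$ denotes $k$th (singular) homology with coefficients in $G$. For $(\vec u,\vec v)\in\Delta^+$, $H_k^{(X,\vec\varphi)}(\vec u,\vec v)$ is the image of the homomorphism $H_k(X\langle\vec\varphi\preceq\vec u\rangle)\to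 H_k(X\langle\vec\varphi\preceq\vec v\rangle)$ induced by inclusion. Natural pseudo-distance: $\delta\left((X,\vec\varphi),(Y,\vec\psi)\right)=\inf_h\|\vec\varphi-\vec\psi\circ h\|_\infty$, where $h$ varies over all homeomorphisms from $X$ to $Y$, if $X$ and $Y$ are homeomorphic; and $=\infty$ if $X$ and $Y$ are not homeomorphic. *)

theory Defs
  imports "HOL-Analysis.Analysis" "HOL-Homology.Homology"
begin

section \<open>Singular homology with coefficients in an Abelian group\<close>

text \<open>
  HOL-Homology provides singular homology with integer coefficients only. For an Abelian group
  \<open>G\<close> (written multiplicatively, as everywhere in HOL-Algebra) the chain group is the direct sum
  of copies of \<open>G\<close> indexed by the singular simplices, i.e. the integral chain group tensored
  with \<open>G\<close>. Degrees are integers, and there are no simplices in negative degree.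
\<close>

definition simplices :: "int \<Rightarrow> 'a topology \<Rightarrow> ((nat \<Rightarrow> real) \<Rightarrow> 'a) set" where
  "simplices k X = (if k < 0 then {} else singular_simplex_set (nat k) X)"

definition coeff_chain_group ::
    "('g, 'm) monoid_scheme \<Rightarrow> int \<Rightarrow> 'a topology \<Rightarrow> (((nat \<Rightarrow> real) \<Rightarrow> 'a) \<Rightarrow> 'g) monoid" where
  "coeff_chain_group G k X = sum_group (simplices k X) (\<lambda>_. G)"

text \<open>
  For an additive map \<open>F\<close> from integral chains on \<open>S\<close> to integral chains on \<open>T\<close>, this is
  \<open>F \<otimes> id\<close> on the direct sums of copies of \<open>G\<close>. In additive notation it sends
  \<open>\<Sum>\<^sub>\<sigma> c(\<sigma>) \<sigma>\<close> to \<open>\<Sum>\<^sub>\<sigma> \<Sum>\<^sub>\<tau> m(\<sigma>,\<tau>) c(\<sigma>) \<tau>\<close>, where the integer \<open>m(\<sigma>,\<tau>)\<close> is the coefficient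
  of \<open>\<tau>\<close> in \<open>F \<sigma>\<close>; the exponent below is that integer.
\<close>

definition coeff_extend ::
    "('g, 'm) monoid_scheme \<Rightarrow> 's set \<Rightarrow> 't set \<Rightarrow> (('s \<Rightarrow>\<^sub>0 int) \<Rightarrow> ('t \<Rightarrow>\<^sub>0 int))
      \<Rightarrow> ('s \<Rightarrow> 'g) \<Rightarrow> ('t \<Rightarrow> 'g)" where
  "coeff_extend G S T F c =
     (\<lambda>\<tau>\<in>T. \<Otimes>\<^bsub>G\<^esub>\<sigma>\<in>{\<sigma> \<in> S. c \<sigma> \<noteq> \<one>\<^bsub>G\<^esub>}.
        c \<sigma> [^]\<^bsub>G\<^esub> Poly_Mapping.lookup (F (frag_of \<sigma>)) \<tau>)"

definition coeff_boundary ::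
    "('g, 'm) monoid_scheme \<Rightarrow> int \<Rightarrow> 'a topology
      \<Rightarrow> (((nat \<Rightarrow> real) \<Rightarrow> 'a) \<Rightarrow> 'g) \<Rightarrow> (((nat \<Rightarrow> real) \<Rightarrow> 'a) \<Rightarrow> 'g)" where
  "coeff_boundary G k X =
     coeff_extend G (simplices k X) (simplices (k - 1) X) (chain_boundary (nat k))"

definition coeff_chain_map ::
    "('g, 'm) monoid_scheme \<Rightarrow> int \<Rightarrow> 'a topology \<Rightarrow> 'b topology \<Rightarrow> ('a \<Rightarrow> 'b)
      \<Rightarrow> (((nat \<Rightarrow> real) \<Rightarrow> 'a) \<Rightarrow> 'g) \<Rightarrow> (((nat \<Rightarrow> real) \<Rightarrow> 'b) \<Rightarrow> 'g)" where
  "coeff_chain_map G k X Y f =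
     coeff_extend G (simplices k X) (simplices k Y) (chain_map (nat k) f)"

definition coeff_cycles ::
    "('g, 'm) monoid_scheme \<Rightarrow> int \<Rightarrow> 'a topology \<Rightarrow> (((nat \<Rightarrow> real) \<Rightarrow> 'a) \<Rightarrow> 'g) set" where
  "coeff_cycles G k X =
     kernel (coeff_chain_group G k X) (coeff_chain_group G (k - 1) X) (coeff_boundary G k X)"

definition coeff_boundaries ::
    "('g, 'm) monoid_scheme \<Rightarrow> int \<Rightarrow> 'a topology \<Rightarrow> (((nat \<Rightarrow> real) \<Rightarrow> 'a) \<Rightarrow> 'g) set" where
  "coeff_boundaries G k X =
     coeff_boundary G (k + 1) X ` carrier (coeff_chain_group G (k + 1) X)"

definition coeff_homology_group ::
    "('g, 'm) monoid_scheme \<Rightarrow> int \<Rightarrow> 'a topology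
      \<Rightarrow> (((nat \<Rightarrow> real) \<Rightarrow> 'a) \<Rightarrow> 'g) set monoid" where
  "coeff_homology_group G k X =
     (coeff_chain_group G k X)\<lparr>carrier := coeff_cycles G k X\<rparr> Mod coeff_boundaries G k X"

text \<open>
  The homomorphism induced by a continuous \<open>f\<close> from \<open>X\<close> to \<open>Y\<close>: the coset of a cycle \<open>z\<close> goes to
  the coset of the image of \<open>z\<close>. Taking the image of the whole coset and saturating it under the
  boundaries of \<open>Y\<close> avoids choosing a representative.
\<close>

definition coeff_hom_induced ::
    "('g, 'm) monoid_scheme \<Rightarrow> int \<Rightarrow> 'a topology \<Rightarrow> 'b topology \<Rightarrow> ('a \<Rightarrow> 'b)
      \<Rightarrow> (((nat \<Rightarrow> real) \<Rightarrow> 'a) \<Rightarrow> 'g) set \<Rightarrow> (((nat \<Rightarrow> real) \<Rightarrow> 'b) \<Rightarrow> 'g) set" where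
  "coeff_hom_induced G k X Y f a =
     coeff_boundaries G k Y <#>\<^bsub>coeff_chain_group G k Y\<^esub> (coeff_chain_map G k X Y f ` a)"


section \<open>Persistent homology groups\<close>

text \<open>
  The library's strict order on vectors is not the componentwise strict one, so the latter is
  spelled out.
\<close>

definition Delta_plus :: "((real ^ 'n) \<times> (real ^ 'n)) set" where
  "Delta_plus = {(u, v). \<forall>i. u $ i < v $ i}"

definition sublevel :: "'a topology \<Rightarrow> ('a \<Rightarrow> real ^ 'n) \<Rightarrow> real ^ 'n \<Rightarrow> 'a topology" where
  "sublevel X \<phi> u = subtopology X {x \<in> topspace X. \<forall>i. \<phi> x $ i \<le> u $ i}"

definition persistent_homology_group ::
    "('g, 'm) monoid_scheme \<Rightarrow> int \<Rightarrow> 'a topology \<Rightarrow> ('a \<Rightarrow> real ^ 'n) \<Rightarrow> real ^ 'n \<Rightarrow> real ^ 'n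
      \<Rightarrow> (((nat \<Rightarrow> real) \<Rightarrow> 'a) \<Rightarrow> 'g) set monoid" where
  "persistent_homology_group G k X \<phi> u v =
     (coeff_homology_group G k (sublevel X \<phi> v))
       \<lparr>carrier := coeff_hom_induced G k (sublevel X \<phi> u) (sublevel X \<phi> v) id
          ` carrier (coeff_homology_group G k (sublevel X \<phi> u))\<rparr>"


section \<open>Natural pseudo-distance\<close>

text \<open>
  \<open>infnorm\<close> is the max-norm. For continuous \<open>f\<close> on a nonempty compact space the supremum is the
  maximum; on the empty space, where there is no maximum, the norm is \<open>0\<close>.
\<close>

definition sup_norm :: "'a topology \<Rightarrow> ('a \<Rightarrow> real ^ 'n) \<Rightarrow> real" where
  "sup_norm X f = (if topspace X = {} then 0 else (SUP x\<in>topspace X. infnorm (f x)))"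

definition natural_pseudo_distance ::
    "'a topology \<Rightarrow> ('a \<Rightarrow> real ^ 'n) \<Rightarrow> 'b topology \<Rightarrow> ('b \<Rightarrow> real ^ 'n) \<Rightarrow> ereal" where
  "natural_pseudo_distance X \<phi> Y \<psi> =
     (if X homeomorphic_space Y
      then (INF h\<in>{h. homeomorphic_map X Y h}. ereal (sup_norm X (\<lambda>x. \<phi> x - \<psi> (h x))))
      else \<infinity>)"

end

theory Submission
  imports Defs
begin

text \<open>
  If the pseudo-distance were smaller than the minimum, some homeomorphism \<open>h\<close> would satisfy
  \<open>\<bar>\<phi>\<^sub>i - \<psi>\<^sub>i \<circ> h\<bar> < min {u\<^sub>i - u'\<^sub>i, v'\<^sub>i - v\<^sub>i}\<close> everywhere. Then \<open>h\<^sup>-\<^sup>1\<close> maps the sublevel set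
  of \<open>u'\<close> into that of \<open>u\<close>, and \<open>h\<close> maps that of \<open>v\<close> into that of \<open>v'\<close>, so the inclusion of the
  sublevel sets of \<open>\<psi>\<close> factors through that of the sublevel sets of \<open>\<phi>\<close>. The image of
  the homology of the sublevel set of \<open>u'\<close> in that of \<open>v\<close> is a subgroup of the persistent homology
  group of \<open>\<phi>\<close>, and \<open>h\<close> induces a surjection from it onto the persistent homology group of \<open>\<psi>\<close>.
\<close>

section \<open>Finite products and integer powers in an Abelian group\<close>

context comm_group
begin

text \<open>This is the interchange of summation behind the composition law for extended maps. If an
  index set is infinite, \<open>finprod\<close> over it is one by convention, and both sides
  collapse to one.\<close>

lemma finprod_swap:
  assumes "\<And>i j. i \<in> A \<Longrightarrow> j \<in> B \<Longrightarrow> f i j \<in> carrier G"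
  shows "(\<Otimes>i\<in>A. \<Otimes>j\<in>B. f i j) = (\<Otimes>j\<in>B. \<Otimes>i\<in>A. f i j)"
  using assms
proof (induction A rule: infinite_finite_induct)
  case (insert a A)
  then have "(\<Otimes>i\<in>insert a A. \<Otimes>j\<in>B. f i j) = (\<Otimes>j\<in>B. f a j) \<otimes> (\<Otimes>j\<in>B. \<Otimes>i\<in>A. f i j)"
    by (subst finprod_insert) (auto intro!: finprod_closed)
  also have "\<dots> = (\<Otimes>j\<in>B. f a j \<otimes> (\<Otimes>i\<in>A. f i j))"
    using insert by (subst finprod_multf) (auto intro!: finprod_closed)
  also have "\<dots> = (\<Otimes>j\<in>B. \<Otimes>i\<in>insert a A. f i j)"
    using insert by (intro finprod_cong' refl) (auto intro!: finprod_closed)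
  finally show ?case .
qed simp_all

lemma finprod_int_pow:
  assumes "\<And>i. i \<in> A \<Longrightarrow> f i \<in> carrier G"
  shows "(\<Otimes>i\<in>A. f i) [^] (n::int) = (\<Otimes>i\<in>A. f i [^] n)"
  using assms
proof (induction A rule: infinite_finite_induct)
  case (insert a A)
  then show ?case
    by (subst (1 2) finprod_insert) (auto simp: int_pow_distrib intro!: finprod_closed)
qed (simp_all add: int_pow_def2)

lemma int_pow_sum:
  assumes "x \<in> carrier G" "finite A"
  shows "x [^] (\<Sum>i\<in>A. n i :: int) = (\<Otimes>i\<in>A. x [^] n i)"
  using assms(2,1)
  by (induction A rule: finite_induct) (auto simp: int_pow_mult)

end

text \<open>Both sides are additive in \<open>c\<close> and agree on generators, so induction on
  free Abelian group elements applies. Summing over a fixed \<open>A\<close> instead of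
  \<open>keys c\<close> keeps the right side linear: cancellation in \<open>a - b\<close> may shrink
  the set of keys.\<close>

lemma additive_lookup_eq_sum:
  assumes diff: "\<And>x y. F (x - y) = F x - F y" and A: "finite A" "Poly_Mapping.keys c \<subseteq> A"
  shows "Poly_Mapping.lookup (F c) \<tau> =
    (\<Sum>t\<in>A. Poly_Mapping.lookup c t * Poly_Mapping.lookup (F (frag_of t)) \<tau> :: int)"
  using A(2)
proof (induction c rule: frag_induction)
  case zero
  then show ?case using diff[of 0 0] by simp
next
  case (one x)
  then show ?case
    using A by (simp add: lookup_single when_def if_distrib[where f = "\<lambda>x. x * _"] cong: if_cong)
next
  case (diff a b)
  then show ?case by (simp add: assms(1) lookup_minus sum_subtractf algebra_simps)
qed

section \<open>Direct sums of copies of \<open>G\<close> and the extension of additive maps to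
  them\<close>

lemma comm_group_sum_group:
  assumes "comm_group G"
  shows "comm_group (sum_group I (\<lambda>_. G))"
proof -
  interpret comm_group G by fact
  interpret S: group "sum_group I (\<lambda>_. G)"
    by (simp add: group_axioms)
  show ?thesis
    by (rule S.group_comm_groupI)
      (auto simp: carrier_sum_group group_axioms PiE_iff m_comm intro!: restrict_ext)
qed

context comm_group
begin

abbreviation chains :: "'s set \<Rightarrow> ('s \<Rightarrow> 'a) set" where
  "chains S \<equiv> carrier (sum_group S (\<lambda>_. G))"

lemma chains_iff:
  "c \<in> chains S \<longleftrightarrow> c \<in> extensional S \<and> (\<forall>s\<in>S. c s \<in> carrier G) \<and> finite {s \<in> S. c s \<noteq> \<one>}"
  by (auto simp: carrier_sum_group group_axioms PiE_iff)

text \<open>Outside the support of \<open>c\<close> every factor is a power of one. Any finite set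
  containing the support may therefore index the product, so that several chains can share one index
  set.\<close>

lemma coeff_extend_eq:
  assumes "c \<in> chains S" "finite A" "A \<subseteq> S" "{s \<in> S. c s \<noteq> \<one>} \<subseteq> A" "\<tau> \<in> T"
  shows "coeff_extend G S T F c \<tau> = (\<Otimes>s\<in>A. c s [^] Poly_Mapping.lookup (F (frag_of s)) \<tau>)"
  unfolding coeff_extend_def using assms
  by (auto simp: chains_iff subset_iff int_pow_one intro!: finprod_mono_neutral_cong_left)

text \<open>The extension evaluates \<open>F\<close> on generators only; identities between chain
  maps thus need checking only on single simplices.\<close>

lemma coeff_extend_cong:
  assumes "c \<in> chains S" "\<And>s. s \<in> S \<Longrightarrow> F (frag_of s) = F' (frag_of s)"
  shows "coeff_extend G S T F c = coeff_extend G S T F' c"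
  unfolding coeff_extend_def using assms
  by (intro restrict_ext finprod_cong') (auto simp: chains_iff)

text \<open>A value other than one needs a factor other than one, hence a nonzero exponent. The
  bound is a finite union of finite sets, which makes the image a finitely supported chain.\<close>

lemma coeff_extend_support:
  assumes "c \<in> chains S"
  shows "{\<tau> \<in> T. coeff_extend G S T F c \<tau> \<noteq> \<one>}
    \<subseteq> (\<Union>s\<in>{s \<in> S. c s \<noteq> \<one>}. Poly_Mapping.keys (F (frag_of s)))"
proof clarify
  fix \<tau> assume "\<tau> \<in> T" and ne: "coeff_extend G S T F c \<tau> \<noteq> \<one>"
  have "\<exists>s\<in>{s \<in> S. c s \<noteq> \<one>}. c s [^] Poly_Mapping.lookup (F (frag_of s)) \<tau> \<noteq> \<one>"
  proof (rule ccontr)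
    assume "\<not> ?thesis"
    then show False
      using ne \<open>\<tau> \<in> T\<close> by (auto simp: coeff_extend_def intro: finprod_one_eqI)
  qed
  then obtain s where s: "s \<in> {s \<in> S. c s \<noteq> \<one>}" "c s [^] Poly_Mapping.lookup (F (frag_of s)) \<tau> \<noteq> \<one>"
    by blast
  then have "Poly_Mapping.lookup (F (frag_of s)) \<tau> \<noteq> 0"
    by (metis int_pow_0)
  with s show "\<tau> \<in> (\<Union>s\<in>{s \<in> S. c s \<noteq> \<one>}. Poly_Mapping.keys (F (frag_of s)))"
    by (auto simp: in_keys_iff)
qed

lemma coeff_extend_closed:
  assumes "c \<in> chains S"
  shows "coeff_extend G S T F c \<in> chains T"
proof -
  have "finite {\<tau> \<in> T. coeff_extend G S T F c \<tau> \<noteq> \<one>}"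
    by (rule finite_subset[OF coeff_extend_support[OF assms]]) (use assms in \<open>auto simp: chains_iff\<close>)
  then show ?thesis
    using assms by (auto simp: chains_iff coeff_extend_def intro!: finprod_closed)
qed

lemma coeff_extend_hom:
  "coeff_extend G S T F \<in> hom (sum_group S (\<lambda>_. G)) (sum_group T (\<lambda>_. G))"
proof (rule homI)
  fix c d assume c: "c \<in> chains S" and d: "d \<in> chains S"
  \<comment> \<open>The union of both supports also contains the support of the product, so all
    three extensions become products over the same set.\<close>
  define A where "A = {s \<in> S. c s \<noteq> \<one>} \<union> {s \<in> S. d s \<noteq> \<one>}"
  have A: "finite A" "A \<subseteq> S" "{s \<in> S. c s \<noteq> \<one>} \<subseteq> A" "{s \<in> S. d s \<noteq> \<one>} \<subseteq> A"
    using c d by (auto simp: A_def chains_iff)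
  let ?cd = "c \<otimes>\<^bsub>sum_group S (\<lambda>_. G)\<^esub> d"
  have cd: "?cd \<in> chains S"
    using c d by (intro monoid.m_closed group.is_monoid) (simp_all add: group_axioms)
  have Acd: "{s \<in> S. ?cd s \<noteq> \<one>} \<subseteq> A"
    using c d by (auto simp: A_def)
  have cA: "\<And>s. s \<in> A \<Longrightarrow> c s \<in> carrier G" "\<And>s. s \<in> A \<Longrightarrow> d s \<in> carrier G"
    using c d A(2) by (auto simp: chains_iff)
  show "coeff_extend G S T F ?cd =
    coeff_extend G S T F c \<otimes>\<^bsub>sum_group T (\<lambda>_. G)\<^esub> coeff_extend G S T F d"
  proof
    fix \<tau>
    show "coeff_extend G S T F ?cd \<tau> =
      (coeff_extend G S T F c \<otimes>\<^bsub>sum_group T (\<lambda>_. G)\<^esub> coeff_extend G S T F d) \<tau>"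
    proof (cases "\<tau> \<in> T")
      case True
      have "coeff_extend G S T F ?cd \<tau> = (\<Otimes>s\<in>A. ?cd s [^] Poly_Mapping.lookup (F (frag_of s)) \<tau>)"
        by (rule coeff_extend_eq[OF cd A(1,2) Acd True])
      also have "\<dots> = (\<Otimes>s\<in>A. c s [^] Poly_Mapping.lookup (F (frag_of s)) \<tau> \<otimes>
          d s [^] Poly_Mapping.lookup (F (frag_of s)) \<tau>)"
        using A(2) cA by (intro finprod_cong' refl) (auto simp: int_pow_distrib subset_iff)
      also have "\<dots> = coeff_extend G S T F c \<tau> \<otimes> coeff_extend G S T F d \<tau>"
        using cA by (subst finprod_multf) (auto simp: coeff_extend_eq[OF c A(1,2,3) True] coeff_extend_eq[OF d A(1,2,4) True])
      finally show ?thesis using True by simp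
    qed (simp add: coeff_extend_def)
  qed
qed (rule coeff_extend_closed)

text \<open>Functoriality of tensoring with \<open>G\<close>: exponents compose like integer
  matrices. Expanding the outer map, interchanging the two products and collecting powers of each
  \<open>c s\<close> yields the coefficient of the composite. The condition on \<open>keys\<close>
  ensures that no part of \<open>F (frag_of s)\<close> is lost by restricting to
  \<open>T\<close>.\<close>

lemma coeff_extend_comp:
  assumes c: "c \<in> chains S" and F: "\<And>s. s \<in> S \<Longrightarrow> Poly_Mapping.keys (F (frag_of s)) \<subseteq> T"
    and diff: "\<And>x y. F' (x - y) = F' x - F' y"
  shows "coeff_extend G T U F' (coeff_extend G S T F c) = coeff_extend G S U (\<lambda>x. F' (F x)) c"
proof
  fix \<tau>
  define A where "A = {s \<in> S. c s \<noteq> \<one>}"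
  \<comment> \<open>\<open>B\<close> serves twice: it contains the support of the intermediate
    chain, and it contains the keys of each \<open>F (frag_of s)\<close> expanded below.\<close>
  define B where "B = (\<Union>s\<in>A. Poly_Mapping.keys (F (frag_of s)))"
  have A: "finite A" "A \<subseteq> S" "\<And>s. s \<in> A \<Longrightarrow> c s \<in> carrier G"
    using c by (auto simp: A_def chains_iff)
  have B: "finite B" "B \<subseteq> T"
    using A F by (auto simp: B_def)
  let ?m = "\<lambda>s t. Poly_Mapping.lookup (F (frag_of s)) t"
  let ?n = "\<lambda>t. Poly_Mapping.lookup (F' (frag_of t)) \<tau>"
  show "coeff_extend G T U F' (coeff_extend G S T F c) \<tau> = coeff_extend G S U (\<lambda>x. F' (F x)) c \<tau>"
  proof (cases "\<tau> \<in> U")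
    case True
    have "coeff_extend G T U F' (coeff_extend G S T F c) \<tau> = (\<Otimes>t\<in>B. coeff_extend G S T F c t [^] ?n t)"
      by (rule coeff_extend_eq[OF coeff_extend_closed[OF c] B _ True])
        (use coeff_extend_support[OF c, of T F] in \<open>simp add: B_def A_def\<close>)
    also have "\<dots> = (\<Otimes>t\<in>B. \<Otimes>s\<in>A. c s [^] (?m s t * ?n t))"
    proof (rule finprod_cong')
      fix t assume t: "t \<in> B"
      then have "coeff_extend G S T F c t = (\<Otimes>s\<in>A. c s [^] ?m s t)"
        using B(2) A(1,2) by (intro coeff_extend_eq[OF c]) (auto simp: A_def)
      then show "coeff_extend G S T F c t [^] ?n t = (\<Otimes>s\<in>A. c s [^] (?m s t * ?n t))"
        using A by (auto simp: finprod_int_pow int_pow_pow intro!: finprod_cong')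
    qed (use A in \<open>auto intro!: finprod_closed\<close>)
    also have "\<dots> = (\<Otimes>s\<in>A. \<Otimes>t\<in>B. c s [^] (?m s t * ?n t))"
      by (rule finprod_swap) (use A in auto)
    also have "\<dots> = (\<Otimes>s\<in>A. c s [^] Poly_Mapping.lookup (F' (F (frag_of s))) \<tau>)"
    proof (rule finprod_cong')
      fix s assume s: "s \<in> A"
      then have "Poly_Mapping.lookup (F' (F (frag_of s))) \<tau> = (\<Sum>t\<in>B. ?m s t * ?n t)"
        by (intro additive_lookup_eq_sum[OF diff B(1)]) (auto simp: B_def)
      then show "(\<Otimes>t\<in>B. c s [^] (?m s t * ?n t)) = c s [^] Poly_Mapping.lookup (F' (F (frag_of s))) \<tau>"
        using s A B(1) by (simp add: int_pow_sum)
    qed (use A in auto)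
    also have "\<dots> = coeff_extend G S U (\<lambda>x. F' (F x)) c \<tau>"
      using True by (simp add: coeff_extend_def A_def)
    finally show ?thesis .
  qed (simp add: coeff_extend_def)
qed

lemma coeff_extend_zero:
  assumes "c \<in> chains S" "\<And>s. s \<in> S \<Longrightarrow> F (frag_of s) = 0"
  shows "coeff_extend G S T F c = \<one>\<^bsub>sum_group T (\<lambda>_. G)\<^esub>"
  unfolding coeff_extend_def using assms
  by (auto intro!: restrict_ext finprod_one_eqI)

end

section \<open>The singular chain complex with coefficients in \<open>G\<close>\<close>

lemma mem_simplices_iff: "s \<in> simplices k X \<longleftrightarrow> 0 \<le> k \<and> singular_simplex (nat k) X s"
  by (auto simp: simplices_def)

context comm_group
begin

lemma comm_group_coeff_chain_group: "comm_group (coeff_chain_group G k X)"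
  by (simp add: coeff_chain_group_def comm_group_sum_group comm_group_axioms)

lemma coeff_boundary_hom:
  "coeff_boundary G k X \<in> hom (coeff_chain_group G k X) (coeff_chain_group G (k - 1) X)"
  by (simp add: coeff_boundary_def coeff_chain_group_def coeff_extend_hom)

lemma coeff_chain_map_hom:
  "coeff_chain_map G k X Y f \<in> hom (coeff_chain_group G k X) (coeff_chain_group G k Y)"
  by (simp add: coeff_chain_map_def coeff_chain_group_def coeff_extend_hom)

lemma coeff_boundary_group_hom:
  "group_hom (coeff_chain_group G k X) (coeff_chain_group G (k - 1) X) (coeff_boundary G k X)"
  by (simp add: group_hom_def group_hom_axioms_def coeff_boundary_hom comm_group_coeff_chain_group comm_group.axioms(2))

lemma coeff_chain_map_group_hom:
  "group_hom (coeff_chain_group G k X) (coeff_chain_group G k Y) (coeff_chain_map G k X Y f)"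
  by (simp add: group_hom_def group_hom_axioms_def coeff_chain_map_hom comm_group_coeff_chain_group comm_group.axioms(2))

lemma keys_chain_boundary_simplex:
  assumes "s \<in> simplices k X"
  shows "Poly_Mapping.keys (chain_boundary (nat k) (frag_of s)) \<subseteq> simplices (k - 1) X"
proof (cases "k = 0")
  \<comment> \<open>Truncation gives \<open>nat (0 - 1) = 0\<close>, so degree zero is separate:
    \<open>chain_boundary 0\<close> vanishes, in accordance with the empty set of simplices in
    degree -1.\<close>
  case True
  then show ?thesis by (simp add: chain_boundary_def)
next
  case False
  then show ?thesis
    using assms singular_chain_boundary[of "nat k" X "frag_of s"]
    by (auto simp: mem_simplices_iff singular_chain_of singular_chain_def nat_diff_distrib)
qed

lemma keys_chain_map_simplex:
  assumes "s \<in> simplices k X" "continuous_map X Y f"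
  shows "Poly_Mapping.keys (chain_map (nat k) f (frag_of s)) \<subseteq> simplices k Y"
  using assms by (auto simp: mem_simplices_iff intro: singular_simplex_simplex_map)

text \<open>The composition law merges the two boundaries into the extension of the integral double
  boundary, which vanishes on every simplex.\<close>

lemma coeff_boundary_boundary:
  assumes "c \<in> carrier (coeff_chain_group G k X)"
  shows "coeff_boundary G (k - 1) X (coeff_boundary G k X c) = \<one>\<^bsub>coeff_chain_group G (k - 2) X\<^esub>"
proof -
  have c: "c \<in> chains (simplices k X)"
    using assms by (simp add: coeff_chain_group_def)
  have "coeff_boundary G (k - 1) X (coeff_boundary G k X c) =
      coeff_extend G (simplices k X) (simplices (k - 2) X)
        (\<lambda>x. chain_boundary (nat (k - 1)) (chain_boundary (nat k) x)) c"
    unfolding coeff_boundary_def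
    by (subst coeff_extend_comp[where F = "chain_boundary (nat k)", OF c keys_chain_boundary_simplex]) (auto simp: chain_boundary_diff)
  also have "\<dots> = \<one>\<^bsub>coeff_chain_group G (k - 2) X\<^esub>"
    unfolding coeff_chain_group_def
  proof (rule coeff_extend_zero[OF c])
    fix s assume "s \<in> simplices k X"
    then show "chain_boundary (nat (k - 1)) (chain_boundary (nat k) (frag_of s)) = 0"
      using chain_boundary_boundary[of "nat k" X "frag_of s"]
      by (simp add: mem_simplices_iff singular_chain_of nat_diff_distrib')
  qed
  finally show ?thesis .
qed

text \<open>Each side is the extension of one integral composite, and the two composites agree on
  simplices by naturality of the integral boundary.\<close>

lemma coeff_boundary_chain_map:
  assumes "c \<in> carrier (coeff_chain_group G k X)" and f: "continuous_map X Y f"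
  shows "coeff_boundary G k Y (coeff_chain_map G k X Y f c) =
    coeff_chain_map G (k - 1) X Y f (coeff_boundary G k X c)"
proof -
  have c: "c \<in> chains (simplices k X)"
    using assms by (simp add: coeff_chain_group_def)
  have "coeff_boundary G k Y (coeff_chain_map G k X Y f c) =
     coeff_extend G (simplices k X) (simplices (k - 1) Y) (\<lambda>x. chain_boundary (nat k) (chain_map (nat k) f x)) c"
    unfolding coeff_boundary_def coeff_chain_map_def
    by (rule coeff_extend_comp[where F = "chain_map (nat k) f", OF c keys_chain_map_simplex[OF _ f]]) (auto simp: chain_boundary_diff)
  also have "\<dots> = coeff_extend G (simplices k X) (simplices (k - 1) Y)
      (\<lambda>x. chain_map (nat (k - 1)) f (chain_boundary (nat k) x)) c"
    by (rule coeff_extend_cong[OF c])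
      (simp add: chain_boundary_chain_map[of _ X] singular_chain_of mem_simplices_iff nat_diff_distrib' del: chain_map_of)
  also have "\<dots> = coeff_chain_map G (k - 1) X Y f (coeff_boundary G k X c)"
    unfolding coeff_boundary_def coeff_chain_map_def
    by (rule coeff_extend_comp[where F = "chain_boundary (nat k)", OF c keys_chain_boundary_simplex, symmetric]) (auto simp: chain_map_diff)
  finally show ?thesis .
qed

lemma coeff_chain_map_compose:
  assumes "c \<in> carrier (coeff_chain_group G k X)" and f: "continuous_map X Y f"
  shows "coeff_chain_map G k Y Z g (coeff_chain_map G k X Y f c) = coeff_chain_map G k X Z (g \<circ> f) c"
proof -
  have c: "c \<in> chains (simplices k X)"
    using assms by (simp add: coeff_chain_group_def)
  show ?thesis
    unfolding coeff_chain_map_def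
    by (subst coeff_extend_comp[where F = "chain_map (nat k) f", OF c keys_chain_map_simplex[OF _ f]]) (auto simp: chain_map_diff chain_map_compose comp_def[of "chain_map _ _"])
qed

lemma coeff_chain_map_cong:
  assumes "c \<in> carrier (coeff_chain_group G k X)" "\<And>x. x \<in> topspace X \<Longrightarrow> f x = g x"
  shows "coeff_chain_map G k X Y f c = coeff_chain_map G k X Y g c"
  unfolding coeff_chain_map_def
proof (rule coeff_extend_cong)
  fix s assume "s \<in> simplices k X"
  then show "chain_map (nat k) f (frag_of s) = chain_map (nat k) g (frag_of s)"
    using assms(2) by (intro chain_map_eq[of _ X]) (auto simp: singular_chain_of mem_simplices_iff)
qed (use assms(1) in \<open>simp add: coeff_chain_group_def\<close>)

section \<open>Cycles, boundaries, homology groups and induced homomorphisms\<close>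

lemma subgroup_coeff_cycles: "subgroup (coeff_cycles G k X) (coeff_chain_group G k X)"
  unfolding coeff_cycles_def using coeff_boundary_group_hom by (rule group_hom.subgroup_kernel)

lemma subgroup_coeff_boundaries: "subgroup (coeff_boundaries G k X) (coeff_chain_group G k X)"
  unfolding coeff_boundaries_def
  using group_hom.img_is_subgroup[OF coeff_boundary_group_hom, of "k + 1" X]
  by simp

lemma coeff_boundaries_subset_cycles: "coeff_boundaries G k X \<subseteq> coeff_cycles G k X"
proof -
  have "coeff_boundary G k X (coeff_boundary G (k + 1) X c) = \<one>\<^bsub>coeff_chain_group G (k - 1) X\<^esub>"
    if "c \<in> carrier (coeff_chain_group G (k + 1) X)" for c
    using coeff_boundary_boundary[OF that] by simp
  then show ?thesis
    using subgroup.subset[OF subgroup_coeff_boundaries[of k X]]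
    by (auto simp: coeff_boundaries_def coeff_cycles_def kernel_def)
qed

lemma coeff_chain_map_cycle:
  assumes z: "z \<in> coeff_cycles G k X" and f: "continuous_map X Y f"
  shows "coeff_chain_map G k X Y f z \<in> coeff_cycles G k Y"
proof -
  have "coeff_chain_map G (k - 1) X Y f (\<one>\<^bsub>coeff_chain_group G (k - 1) X\<^esub>) = \<one>\<^bsub>coeff_chain_group G (k - 1) Y\<^esub>"
    by (rule group_hom.hom_one[OF coeff_chain_map_group_hom])
  then show ?thesis
    using z coeff_boundary_chain_map[OF _ f, of z k] hom_in_carrier[OF coeff_chain_map_hom]
    by (auto simp: coeff_cycles_def kernel_def)
qed

lemma coeff_chain_map_boundaries:
  assumes f: "continuous_map X Y f"
  shows "coeff_chain_map G k X Y f ` coeff_boundaries G k X \<subseteq> coeff_boundaries G k Y"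
proof clarify
  fix b assume "b \<in> coeff_boundaries G k X"
  then obtain c where c: "c \<in> carrier (coeff_chain_group G (k + 1) X)" "b = coeff_boundary G (k + 1) X c"
    by (auto simp: coeff_boundaries_def)
  then have "coeff_chain_map G k X Y f b = coeff_boundary G (k + 1) Y (coeff_chain_map G (k + 1) X Y f c)"
    using coeff_boundary_chain_map[OF c(1) f] by simp
  then show "coeff_chain_map G k X Y f b \<in> coeff_boundaries G k Y"
    unfolding coeff_boundaries_def using hom_in_carrier[OF coeff_chain_map_hom c(1)] by (metis imageI)
qed

lemma normal_coeff_boundaries:
  "coeff_boundaries G k X \<lhd> (coeff_chain_group G k X)\<lparr>carrier := coeff_cycles G k X\<rparr>"
proof -
  interpret C: comm_group "coeff_chain_group G k X"
    by (rule comm_group_coeff_chain_group)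
  show ?thesis
    by (rule C.normal_restrict_supergroup[OF subgroup_coeff_cycles
          C.subgroup_imp_normal[OF subgroup_coeff_boundaries] coeff_boundaries_subset_cycles])
qed

lemma group_coeff_homology_group: "group (coeff_homology_group G k X)"
  unfolding coeff_homology_group_def by (rule normal.factorgroup_is_group[OF normal_coeff_boundaries])

text \<open>Cosets are taken in the whole chain group. Restricting the carrier to the cycles keeps
  the multiplication, so these are the same sets as in the quotient.\<close>

abbreviation homology_class where
  "homology_class k X z \<equiv> coeff_boundaries G k X #>\<^bsub>coeff_chain_group G k X\<^esub> z"

lemma carrier_coeff_homology_group:
  "carrier (coeff_homology_group G k X) = homology_class k X ` coeff_cycles G k X"
  by (auto simp: coeff_homology_group_def FactGroup_def RCOSETS_def r_coset_def)

lemma mult_coeff_homology_group: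
  assumes "z \<in> coeff_cycles G k X" "w \<in> coeff_cycles G k X"
  shows "homology_class k X z \<otimes>\<^bsub>coeff_homology_group G k X\<^esub> homology_class k X w =
    homology_class k X (z \<otimes>\<^bsub>coeff_chain_group G k X\<^esub> w)"
  using normal.rcos_sum[OF normal_coeff_boundaries, of z k X w] assms
  by (simp add: coeff_homology_group_def FactGroup_def r_coset_def set_mult_def)

text \<open>The image of a coset is a coset of the image of the boundaries of \<open>X\<close>. That
  image lies in the boundaries of \<open>Y\<close>, so the saturation absorbs it and leaves the full
  class of the image chain. Later facts on induced maps reduce to representatives in this
  way.\<close>

lemma coeff_hom_induced_class:
  assumes f: "continuous_map X Y f" and z: "z \<in> carrier (coeff_chain_group G k X)"
  shows "coeff_hom_induced G k X Y f (homology_class k X z) =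
    homology_class k Y (coeff_chain_map G k X Y f z)"
proof -
  let ?C = "coeff_chain_group G k X" and ?D = "coeff_chain_group G k Y"
  let ?F = "coeff_chain_map G k X Y f"
  interpret D: comm_group ?D by (rule comm_group_coeff_chain_group)
  interpret F: group_hom ?C ?D ?F by (rule coeff_chain_map_group_hom)
  note B = subgroup.subset[OF subgroup_coeff_boundaries]
  have img: "?F ` (homology_class k X z) = (?F ` coeff_boundaries G k X) #>\<^bsub>?D\<^esub> ?F z"
    using B[of k X] z by (force simp: r_coset_def)
  have FB: "subgroup (?F ` coeff_boundaries G k X) ?D"
    by (rule F.subgroup_img_is_subgroup[OF subgroup_coeff_boundaries])
  have "coeff_boundaries G k Y <#>\<^bsub>?D\<^esub> (?F ` coeff_boundaries G k X) = coeff_boundaries G k Y"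
    by (rule D.set_mult_subgroup_idem[OF subgroup_coeff_boundaries
          D.subgroup_incl[OF FB subgroup_coeff_boundaries coeff_chain_map_boundaries[OF f]]])
  then show ?thesis
    unfolding coeff_hom_induced_def img
    using D.setmult_rcos_assoc[OF B subgroup.subset[OF FB], of "?F z"] z by simp
qed

lemma coeff_hom_induced_hom:
  assumes f: "continuous_map X Y f"
  shows "coeff_hom_induced G k X Y f \<in> hom (coeff_homology_group G k X) (coeff_homology_group G k Y)"
proof (rule homI)
  have Z: "\<And>X z. z \<in> coeff_cycles G k X \<Longrightarrow> z \<in> carrier (coeff_chain_group G k X)"
    using subgroup.mem_carrier[OF subgroup_coeff_cycles] .
  fix a assume "a \<in> carrier (coeff_homology_group G k X)"
  then show "coeff_hom_induced G k X Y f a \<in> carrier (coeff_homology_group G k Y)"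
    using coeff_chain_map_cycle[OF _ f]
    by (auto simp: carrier_coeff_homology_group coeff_hom_induced_class[OF f] Z)
  fix b assume "b \<in> carrier (coeff_homology_group G k X)"
  with \<open>a \<in> _\<close> obtain z w where
    zw: "z \<in> coeff_cycles G k X" "a = homology_class k X z"
        "w \<in> coeff_cycles G k X" "b = homology_class k X w"
    by (auto simp: carrier_coeff_homology_group)
  show "coeff_hom_induced G k X Y f (a \<otimes>\<^bsub>coeff_homology_group G k X\<^esub> b) =
    coeff_hom_induced G k X Y f a \<otimes>\<^bsub>coeff_homology_group G k Y\<^esub> coeff_hom_induced G k X Y f b"
    using zw subgroup.m_closed[OF subgroup_coeff_cycles zw(1,3)]
    by (simp add: mult_coeff_homology_group coeff_hom_induced_class[OF f] Z
        coeff_chain_map_cycle[OF _ f] hom_mult[OF coeff_chain_map_hom])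
qed

lemma coeff_hom_induced_compose:
  assumes f: "continuous_map X Y f" and g: "continuous_map Y Z g"
    and a: "a \<in> carrier (coeff_homology_group G k X)"
  shows "coeff_hom_induced G k Y Z g (coeff_hom_induced G k X Y f a) = coeff_hom_induced G k X Z (g \<circ> f) a"
proof -
  obtain z where z: "z \<in> coeff_cycles G k X" "a = homology_class k X z"
    using a by (auto simp: carrier_coeff_homology_group)
  have zc: "z \<in> carrier (coeff_chain_group G k X)"
    using z(1) by (rule subgroup.mem_carrier[OF subgroup_coeff_cycles])
  show ?thesis
    unfolding z(2) coeff_hom_induced_class[OF f zc]
      coeff_hom_induced_class[OF g hom_in_carrier[OF coeff_chain_map_hom zc]]
      coeff_hom_induced_class[OF continuous_map_compose[OF f g] zc] coeff_chain_map_compose[OF zc f] ..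
qed

text \<open>A homology class is a set of chains in \<open>X\<close>, and on each of them the chain
  map sees only the values on \<open>topspace X\<close>.\<close>

lemma coeff_hom_induced_cong:
  assumes "a \<in> carrier (coeff_homology_group G k X)" "\<And>x. x \<in> topspace X \<Longrightarrow> f x = g x"
  shows "coeff_hom_induced G k X Y f a = coeff_hom_induced G k X Y g a"
proof -
  have "a \<subseteq> carrier (coeff_chain_group G k X)"
    using assms(1) subgroup.subset[OF subgroup_coeff_cycles]
      monoid.r_coset_subset_G[OF group.is_monoid[OF comm_group.axioms(2)[OF comm_group_coeff_chain_group]]
        subgroup.subset[OF subgroup_coeff_boundaries]]
    by (fastforce simp: carrier_coeff_homology_group)
  then have "coeff_chain_map G k X Y f ` a = coeff_chain_map G k X Y g ` a"
    using assms(2) by (intro image_cong refl coeff_chain_map_cong) auto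
  then show ?thesis
    by (simp add: coeff_hom_induced_def)
qed

section \<open>Comparison of persistent homology groups\<close>

lemma persistent_homology_group_sub_epi:
  fixes \<phi> :: "'x \<Rightarrow> real ^ 'n" and \<psi> :: "'y \<Rightarrow> real ^ 'n"
  assumes p: "continuous_map (sublevel Y \<psi> u') (sublevel X \<phi> u) p"
    and i: "continuous_map (sublevel X \<phi> u) (sublevel X \<phi> v) id"
    and h: "continuous_map (sublevel X \<phi> v) (sublevel Y \<psi> v') h"
    and hp: "\<And>y. y \<in> topspace (sublevel Y \<psi> u') \<Longrightarrow> h (p y) = y"
  shows "\<exists>S f. subgroup S (persistent_homology_group G k X \<phi> u v) \<and>
    f \<in> epi ((persistent_homology_group G k X \<phi> u v)\<lparr>carrier := S\<rparr>) (persistent_homology_group G k Y \<psi> u' v')"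
proof -
  let ?Xu = "sublevel X \<phi> u" and ?Xv = "sublevel X \<phi> v"
  let ?Yu = "sublevel Y \<psi> u'" and ?Yv = "sublevel Y \<psi> v'"
  let ?H = "\<lambda>Z. coeff_homology_group G k Z"
  let ?ind = "\<lambda>A B f. coeff_hom_induced G k A B f"
  \<comment> \<open>Followed by the inclusion, \<open>p\<close> is still the same function, now with
    values in the larger sublevel set.\<close>
  note ip = continuous_map_compose[OF p i, unfolded id_comp]
  interpret I: group_hom "?H ?Xu" "?H ?Xv" "?ind ?Xu ?Xv id"
    by (simp add: group_hom_def group_hom_axioms_def group_coeff_homology_group coeff_hom_induced_hom i)
  interpret P: group_hom "?H ?Yu" "?H ?Xv" "?ind ?Yu ?Xv p"
    by (simp add: group_hom_def group_hom_axioms_def group_coeff_homology_group coeff_hom_induced_hom ip)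
  define S where "S = ?ind ?Yu ?Xv p ` carrier (?H ?Yu)"
  \<comment> \<open>Factoring through the smaller sublevel set of \<open>X\<close> places
    \<open>S\<close> inside the persistent homology group.\<close>
  have "?ind ?Yu ?Xv p a = ?ind ?Xu ?Xv id (?ind ?Yu ?Xu p a)" if "a \<in> carrier (?H ?Yu)" for a
    using coeff_hom_induced_compose[OF p i that] by simp
  then have sub: "S \<subseteq> ?ind ?Xu ?Xv id ` carrier (?H ?Xu)"
    using hom_in_carrier[OF coeff_hom_induced_hom[OF p, of k]] by (auto simp: S_def)
  \<comment> \<open>Both carriers are images of homomorphisms into the homology of
    \<open>sublevel X \<phi> v\<close>, with its multiplication, so containment suffices.\<close>
  have "subgroup S (persistent_homology_group G k X \<phi> u v)"
    unfolding persistent_homology_group_def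
    using P.img_is_subgroup I.img_is_subgroup sub unfolding S_def by (rule I.H.subgroup_incl)
  moreover have "?ind ?Xv ?Yv h \<in> epi ((persistent_homology_group G k X \<phi> u v)\<lparr>carrier := S\<rparr>)
      (persistent_homology_group G k Y \<psi> u' v')"
  proof -
    \<comment> \<open>On the smaller sublevel set of \<open>Y\<close> the composite of
      \<open>p\<close> and \<open>h\<close> is the identity, so \<open>h\<close> carries
      \<open>S\<close> exactly onto the image that defines the target group.\<close>
    have "?ind ?Xv ?Yv h (?ind ?Yu ?Xv p a) = ?ind ?Yu ?Yv id a" if a: "a \<in> carrier (?H ?Yu)" for a
      unfolding coeff_hom_induced_compose[OF ip h a] by (rule coeff_hom_induced_cong[OF a]) (simp add: hp)
    then have img: "?ind ?Xv ?Yv h ` S = ?ind ?Yu ?Yv id ` carrier (?H ?Yu)"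
      by (force simp: S_def)
    have "S \<subseteq> carrier (?H ?Xv)"
      by (auto simp: S_def)
    then have "?ind ?Xv ?Yv h (a \<otimes>\<^bsub>?H ?Xv\<^esub> b) = ?ind ?Xv ?Yv h a \<otimes>\<^bsub>?H ?Yv\<^esub> ?ind ?Xv ?Yv h b"
      if "a \<in> S" "b \<in> S" for a b
      using that hom_mult[OF coeff_hom_induced_hom[OF h]] by blast
    with img show ?thesis
      by (auto simp: epi_def hom_def persistent_homology_group_def)
  qed
  ultimately show ?thesis by blast
qed

end

section \<open>Sublevel sets and the max-norm\<close>

lemma topspace_sublevel: "topspace (sublevel X \<phi> u) = {x \<in> topspace X. \<forall>i. \<phi> x $ i \<le> u $ i}"
  by (auto simp: sublevel_def)

lemma continuous_map_sublevel:
  assumes "continuous_map X Y f"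
    and "\<And>x i. x \<in> topspace X \<Longrightarrow> (\<And>i. \<phi> x $ i \<le> u $ i) \<Longrightarrow> \<psi> (f x) $ i \<le> v $ i"
  shows "continuous_map (sublevel X \<phi> u) (sublevel Y \<psi> v) f"
  unfolding sublevel_def using assms continuous_map_image_subset_topspace[OF assms(1)]
  by (auto simp: continuous_map_in_subtopology continuous_map_from_subtopology)

text \<open>Compactness bounds the image of \<open>f\<close>; this makes the real \<open>SUP\<close>
  a genuine upper bound of the values \<open>infnorm (f x)\<close>, each of which dominates the
  components.\<close>

lemma component_le_sup_norm:
  fixes f :: "'a \<Rightarrow> real ^ 'n"
  assumes "compact_space X" "continuous_map X euclidean f" "x \<in> topspace X"
  shows "\<bar>f x $ i\<bar> \<le> sup_norm X f"
proof -
  have "compact (f ` topspace X)"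
    using image_compactin[of X "topspace X" euclidean f] assms(1,2)
    by (simp add: compact_space_def)
  then obtain B where "\<And>y. y \<in> f ` topspace X \<Longrightarrow> norm y \<le> B"
    using compact_imp_bounded bounded_iff by metis
  then have "bdd_above ((\<lambda>x. infnorm (f x)) ` topspace X)"
    using infnorm_le_norm order_trans by (intro bdd_aboveI[of _ B]) blast
  then have "infnorm (f x) \<le> sup_norm X f"
    using assms(3) by (auto simp: sup_norm_def intro: cSUP_upper)
  then show ?thesis
    using component_le_infnorm_cart order_trans by blast
qed

theorem corollary2p9:
  fixes X :: "'a topology" and Y :: "'b topology"
    and \<phi> :: "'a \<Rightarrow> real ^ 'n" and \<psi> :: "'b \<Rightarrow> real ^ 'n"
    and k :: int and G :: "('g, 'm) monoid_scheme"
    and u v u' v' :: "real ^ 'n"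
  assumes "compact_space X" and "compact_space Y"
    and "continuous_map X euclidean \<phi>" and "continuous_map Y euclidean \<psi>"
    and "comm_group G"
    and "(u, v) \<in> Delta_plus" and "(u', v') \<in> Delta_plus"
    and "\<not> (\<exists>S f. subgroup S (persistent_homology_group G k X \<phi> u v) \<and>
             f \<in> epi ((persistent_homology_group G k X \<phi> u v)\<lparr>carrier := S\<rparr>)
                      (persistent_homology_group G k Y \<psi> u' v'))"
  shows "natural_pseudo_distance X \<phi> Y \<psi>
           \<ge> ereal (MIN i. min (u $ i - u' $ i) (v' $ i - v $ i))"
proof -
  define m where "m = (MIN i. min (u $ i - u' $ i) (v' $ i - v $ i))"
  have m: "m \<le> u $ i - u' $ i" "m \<le> v' $ i - v $ i" for i
  proof -
    have "m \<le> min (u $ i - u' $ i) (v' $ i - v $ i)"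
      unfolding m_def by (rule Min_le) auto
    then show "m \<le> u $ i - u' $ i" "m \<le> v' $ i - v $ i" by auto
  qed
  have "m \<le> sup_norm X (\<lambda>x. \<phi> x - \<psi> (h x))" if hom: "homeomorphic_map X Y h" for h
  proof (rule ccontr)
    assume less: "\<not> ?thesis"
    obtain p where hp: "homeomorphic_maps X Y h p"
      using hom homeomorphic_map_maps by blast
    then have ch: "continuous_map X Y h" and cp: "continuous_map Y X p"
      and ph: "\<And>y. y \<in> topspace Y \<Longrightarrow> h (p y) = y"
      by (auto simp: homeomorphic_maps_def)
    have "continuous_map X euclidean (\<lambda>x. \<psi> (h x))"
      using continuous_map_compose[OF ch assms(4)] by (simp add: o_def)
    then have "continuous_map X euclidean (\<lambda>x. \<phi> x - \<psi> (h x))"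
      by (intro continuous_map_diff assms(3))
    \<comment> \<open>The strict bound on the supremum passes to every point and every
      coordinate.\<close>
    then have close: "\<bar>\<phi> x $ i - \<psi> (h x) $ i\<bar> < m" if "x \<in> topspace X" for x i
      using component_le_sup_norm[OF assms(1) _ that, of _ i] less by fastforce
    have "continuous_map (sublevel Y \<psi> u') (sublevel X \<phi> u) p"
    proof (rule continuous_map_sublevel[OF cp])
      fix y i assume y: "y \<in> topspace Y" "\<And>i. \<psi> y $ i \<le> u' $ i"
      then have "p y \<in> topspace X"
        using continuous_map_image_subset_topspace[OF cp] by auto
      \<comment> \<open>With \<open>h (p y) = y\<close>, the chain is \<open>\<phi> (p y) $ i <
        \<psi> y $ i + m \<le> u' $ i + m \<le> u $ i\<close>.\<close>
      then show "\<phi> (p y) $ i \<le> u $ i"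
        using close[of "p y" i] ph[OF y(1)] y(2)[of i] m(1)[of i] by simp
    qed
    moreover have "continuous_map (sublevel X \<phi> u) (sublevel X \<phi> v) id"
    proof (rule continuous_map_sublevel)
      show "\<phi> (id x) $ i \<le> v $ i" if "\<And>i. \<phi> x $ i \<le> u $ i" for x i
        using that[of i] assms(6) unfolding Delta_plus_def by (force intro: order.trans less_imp_le)
    qed simp
    moreover have "continuous_map (sublevel X \<phi> v) (sublevel Y \<psi> v') h"
    proof (rule continuous_map_sublevel[OF ch])
      \<comment> \<open>Likewise \<open>\<psi> (h x) $ i < \<phi> x $ i + m \<le> v $ i + m \<le> v'
        $ i\<close>.\<close>
      show "\<psi> (h x) $ i \<le> v' $ i" if "x \<in> topspace X" "\<And>i. \<phi> x $ i \<le> v $ i" for x i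
        using close[OF that(1), of i] that(2)[of i] m(2)[of i] by simp
    qed
    ultimately have "\<exists>S f. subgroup S (persistent_homology_group G k X \<phi> u v) \<and>
        f \<in> epi ((persistent_homology_group G k X \<phi> u v)\<lparr>carrier := S\<rparr>)
              (persistent_homology_group G k Y \<psi> u' v')"
      by (rule comm_group.persistent_homology_group_sub_epi[OF assms(5)])
        (simp add: topspace_sublevel ph)
    with assms(8) show False by contradiction
  qed
  \<comment> \<open>Every term of the infimum is at least \<open>m\<close>; for spaces that are not
    homeomorphic the distance is infinite.\<close>
  then show ?thesis
    unfolding natural_pseudo_distance_def m_def[symmetric]
    by (auto intro!: INF_greatest)
qed

end
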